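(* Let $n=2$ and suppose $l>2$. Then the kernel of the ring homomorphism $S\to H^0(Y,\mathcal{O}_Y)$ is generated by $\det(M)$, $\det(N)$, the entries of $MN-NM$, and $\operatorname{tr}(MN)$; that is, $X\subset\mathfrak{g}^2$ is the closed subscheme cut out by these equations.
   Context: Let $\mathbb{F}$ be a field of characteristic $l$, $G=SL_2$ over $\mathbb{F}$, $B$ the upper triangular Borel subgroup, $\mathfrak{g}=\mathfrak{sl}_2$, $\mathfrak{n}$ the strictly upper triangular matrices. Let $Y=G\times^B(\mathfrak{n}\times\mathfrak{n})$ (a vector bundle over $G/B$) and let $p:Y\to\mathfrak{g}\times\mathfrak{g}$, $(g,(M,N))\mapsto(\mathrm{Ad}(g)M,\mathrm{Ad}(g)N)$. Let $S=\operatorname{Sym}((\mathfrak{g}^* )^2)$ be the coordinate ring of $\mathfrak{g}\times\mathfrak{g}$, with $(M,N)$ the universal pair of matrices over $S$, and $S\to H^0(Y,\mathcal{O}_Y)$ the map induced by $p$. $X$ is the closed subscheme of $\mathfrak{g}^2$ defined by the kernel of this map (the scheme-theoretic image of $p$). In the arithmetic setting (local field with residue field of order $q\equiv1\bmod l$), $X$ is identified with the reduced special fibre of the Steinberg component with fixed trace of $\Phi$, via $(\Phi,\Sigma)\mapsto(\Phi-1,\log\Sigma)$. *)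

theory Defs
  imports "HOL-Analysis.Analysis" "HOL-Algebra.Algebraic_Closure_Type"
    "HOL-Algebra.QuotRing" "HOL-Library.Poly_Mapping"
begin

unbundle no Formal_Power_Series.fps_syntax

section \<open>Polynomial rings\<close>

type_synonym ('v, 'a) mpoly = "('v \<Rightarrow>\<^sub>0 nat) \<Rightarrow>\<^sub>0 'a"

definition mconst :: "'a::comm_ring_1 \<Rightarrow> ('v, 'a) mpoly"
  where "mconst c = Poly_Mapping.single 0 c"

definition mvar :: "'v \<Rightarrow> ('v, 'a::comm_ring_1) mpoly"
  where "mvar v = Poly_Mapping.single (Poly_Mapping.single v 1) 1"

text \<open>The image of \<open>f\<close> under the map that is \<open>h\<close> on coefficients and sends the variable
  \<open>v\<close> to \<open>x v\<close>; for a ring homomorphism \<open>h\<close> it is a ring homomorphism.\<close>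

definition poly_eval ::
  "('a::comm_ring_1 \<Rightarrow> 'r::comm_ring_1) \<Rightarrow> ('v \<Rightarrow> 'r) \<Rightarrow> ('v, 'a) mpoly \<Rightarrow> 'r"
  where "poly_eval h x f =
    (\<Sum>m\<in>Poly_Mapping.keys f. h (Poly_Mapping.lookup f m) *
       (\<Prod>v\<in>Poly_Mapping.keys m. x v ^ Poly_Mapping.lookup m v))"

section \<open>Points of the schemes involved\<close>

text \<open>Schemes are handled through coordinates with values in a commutative ring \<open>'r\<close>; taking
  \<open>'r\<close> to be a polynomial ring and the coordinates to be its variables gives the universal
  point.\<close>

definition mat2 :: "'r::comm_ring_1 \<Rightarrow> 'r \<Rightarrow> 'r \<Rightarrow> 'r \<Rightarrow> 'r^2^2"
  where "mat2 a b c d = vector [vector [a, b], vector [c, d]]"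

text \<open>The adjugate, i.e. the inverse of \<open>g\<close> in \<open>SL\<^sub>2\<close>.\<close>

definition adj2 :: "'r::comm_ring_1^2^2 \<Rightarrow> 'r^2^2"
  where "adj2 g = mat2 (g$2$2) (- g$1$2) (- g$2$1) (g$1$1)"

definition Ad :: "'r::comm_ring_1^2^2 \<Rightarrow> 'r^2^2 \<Rightarrow> 'r^2^2"
  where "Ad g A = g ** A ** adj2 g"

text \<open>Coordinates on \<open>\<gg> \<times> \<gg>\<close>: the entries of a pair \<open>(M, N)\<close> of trace zero matrices, the
  lower right entries being \<open>- M11\<close> and \<open>- N11\<close>. Hence \<open>S\<close> is the polynomial ring in these six
  variables.\<close>

datatype gg_var = M11 | M12 | M21 | N11 | N12 | N21

definition mat_M :: "(gg_var \<Rightarrow> 'r::comm_ring_1) \<Rightarrow> 'r^2^2"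
  where "mat_M x = mat2 (x M11) (x M12) (x M21) (- x M11)"

definition mat_N :: "(gg_var \<Rightarrow> 'r::comm_ring_1) \<Rightarrow> 'r^2^2"
  where "mat_N x = mat2 (x N11) (x N12) (x N21) (- x N11)"

definition gg_coords :: "'r::comm_ring_1^2^2 \<Rightarrow> 'r^2^2 \<Rightarrow> gg_var \<Rightarrow> 'r"
  where "gg_coords M N v = (case v of
    M11 \<Rightarrow> M$1$1 | M12 \<Rightarrow> M$1$2 | M21 \<Rightarrow> M$2$1 | N11 \<Rightarrow> N$1$1 | N12 \<Rightarrow> N$1$2 | N21 \<Rightarrow> N$2$1)"

text \<open>Coordinates on \<open>G \<times> (\<nn> \<times> \<nn>)\<close>: the four entries of \<open>g\<close> (subject to \<open>det g = 1\<close>) and the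
  upper right entries of the two strictly upper triangular matrices.\<close>

datatype gnn_var = G11 | G12 | G21 | G22 | XM | XN

definition mat_g :: "(gnn_var \<Rightarrow> 'r::comm_ring_1) \<Rightarrow> 'r^2^2"
  where "mat_g z = mat2 (z G11) (z G12) (z G21) (z G22)"

definition nil_M :: "(gnn_var \<Rightarrow> 'r::comm_ring_1) \<Rightarrow> 'r^2^2"
  where "nil_M z = mat2 0 (z XM) 0 0"

definition nil_N :: "(gnn_var \<Rightarrow> 'r::comm_ring_1) \<Rightarrow> 'r^2^2"
  where "nil_N z = mat2 0 (z XN) 0 0"

definition gnn_coords ::
  "'r::comm_ring_1^2^2 \<Rightarrow> 'r^2^2 \<Rightarrow> 'r^2^2 \<Rightarrow> gnn_var \<Rightarrow> 'r"
  where "gnn_coords g M N v = (case v of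
    G11 \<Rightarrow> g$1$1 | G12 \<Rightarrow> g$1$2 | G21 \<Rightarrow> g$2$1 | G22 \<Rightarrow> g$2$2 | XM \<Rightarrow> M$1$2 | XN \<Rightarrow> N$1$2)"

text \<open>Coordinates on the Borel subgroup \<open>B\<close>: the entries on and above the diagonal (subject to
  \<open>det b = 1\<close>).\<close>

datatype b_var = B11 | B12 | B22

definition mat_b :: "(b_var \<Rightarrow> 'r::comm_ring_1) \<Rightarrow> 'r^2^2"
  where "mat_b y = mat2 (y B11) (y B12) 0 (y B22)"

text \<open>The map \<open>(g, (M, N)) \<mapsto> (Ad(g) M, Ad(g) N)\<close> in coordinates.\<close>

definition p_coords :: "(gnn_var \<Rightarrow> 'r::comm_ring_1) \<Rightarrow> gg_var \<Rightarrow> 'r"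
  where "p_coords z = gg_coords (Ad (mat_g z) (nil_M z)) (Ad (mat_g z) (nil_N z))"

text \<open>The right action of \<open>B\<close> on \<open>G \<times> (\<nn> \<times> \<nn>)\<close> whose quotient is \<open>G \<times>\<^sup>B (\<nn> \<times> \<nn>)\<close>:
  \<open>(g, (M, N)) b = (g b, (Ad(b\<^sup>-\<^sup>1) M, Ad(b\<^sup>-\<^sup>1) N))\<close>.\<close>

definition act_coords ::
  "(gnn_var \<Rightarrow> 'r::comm_ring_1) \<Rightarrow> (b_var \<Rightarrow> 'r) \<Rightarrow> gnn_var \<Rightarrow> 'r"
  where "act_coords z y = gnn_coords (mat_g z ** mat_b y)
    (Ad (adj2 (mat_b y)) (nil_M z)) (Ad (adj2 (mat_b y)) (nil_N z))"

section \<open>The coordinate rings and the global sections of the structure sheaf of \<open>Y\<close>\<close>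

definition S_ring :: "(gg_var, 'a::field) mpoly ring"
  where "S_ring = ring_of_type_algebra"

definition univ_M :: "(gg_var, 'a::field) mpoly^2^2"
  where "univ_M = mat_M mvar"

definition univ_N :: "(gg_var, 'a::field) mpoly^2^2"
  where "univ_N = mat_N mvar"

text \<open>\<open>G \<times> (\<nn> \<times> \<nn>)\<close> and \<open>B \<times> (G \<times> (\<nn> \<times> \<nn>))\<close> are the affine schemes with coordinate rings
  the polynomial rings modulo the following ideals.\<close>

definition gnn_ideal :: "(gnn_var, 'a::field) mpoly set"
  where "gnn_ideal = Idl\<^bsub>ring_of_type_algebra\<^esub> {det (mat_g mvar) - 1}"

definition bgnn_ideal :: "(b_var + gnn_var, 'a::field) mpoly set"
  where "bgnn_ideal = Idl\<^bsub>ring_of_type_algebra\<^esub>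
    {det (mat_b (\<lambda>v. mvar (Inl v))) - 1, det (mat_g (\<lambda>v. mvar (Inr v))) - 1}"

text \<open>Pullbacks of functions along the projection and along the action
  \<open>B \<times> (G \<times> (\<nn> \<times> \<nn>)) \<rightarrow> G \<times> (\<nn> \<times> \<nn>)\<close>, on polynomial representatives.\<close>

definition pr_pullback :: "(gnn_var, 'a::field) mpoly \<Rightarrow> (b_var + gnn_var, 'a) mpoly"
  where "pr_pullback = poly_eval mconst (\<lambda>v. mvar (Inr v))"

definition act_pullback :: "(gnn_var, 'a::field) mpoly \<Rightarrow> (b_var + gnn_var, 'a) mpoly"
  where "act_pullback =
    poly_eval mconst (act_coords (\<lambda>v. mvar (Inr v)) (\<lambda>v. mvar (Inl v)))"

text \<open>The structure sheaf of the quotient \<open>Y\<close> of \<open>G \<times> (\<nn> \<times> \<nn>)\<close> by \<open>B\<close> consists of the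
  \<open>B\<close>-invariant functions, so \<open>H\<^sup>0(Y, \<O>\<^sub>Y)\<close> is the ring of those functions on
  \<open>G \<times> (\<nn> \<times> \<nn>)\<close> that have equal pullbacks along the projection and the action. Invariance is
  scheme theoretic: the \<open>\<bbbF>\<close>-rational points of \<open>B\<close> would not suffice for finite \<open>\<bbbF>\<close>.\<close>

definition H0_Y :: "(gnn_var, 'a::field) mpoly set ring"
  where "H0_Y = (ring_of_type_algebra Quot gnn_ideal)
    \<lparr>carrier := {gnn_ideal +>\<^bsub>ring_of_type_algebra\<^esub> f | f.
       bgnn_ideal +>\<^bsub>ring_of_type_algebra\<^esub> act_pullback f =
       bgnn_ideal +>\<^bsub>ring_of_type_algebra\<^esub> pr_pullback f}\<rparr>"

definition p_sharp :: "(gg_var, 'a::field) mpoly \<Rightarrow> (gnn_var, 'a) mpoly set"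
  where "p_sharp f = gnn_ideal +>\<^bsub>ring_of_type_algebra\<^esub> poly_eval mconst (p_coords mvar) f"

section \<open>Closed subschemes of \<open>\<gg> \<times> \<gg>\<close>\<close>

text \<open>The \<open>'r\<close>-valued points, for the \<open>\<bbbF>\<close>-algebra structure \<open>h\<close> on \<open>'r\<close>, of the closed subscheme
  of \<open>\<gg> \<times> \<gg>\<close> defined by the ideal \<open>I\<close>.\<close>

definition subscheme_points ::
  "(gg_var, 'a::field) mpoly set \<Rightarrow> ('a \<Rightarrow> 'r::comm_ring_1) \<Rightarrow> (('r^2^2) \<times> ('r^2^2)) set"
  where "subscheme_points I h = {(M, N). trace M = 0 \<and> trace N = 0 \<and>
    (\<forall>f\<in>I. poly_eval h (gg_coords M N) f = 0)}"

section \<open>Well-definedness of the pullback to \<open>Y\<close>\<close>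

lemma poly_eval_0 [simp]: "poly_eval h x 0 = 0"
  by (simp add: poly_eval_def)

context
  fixes h :: "'a::comm_ring_1 \<Rightarrow> 'r::comm_ring_1"
  assumes h_add: "\<And>a b. h (a + b) = h a + h b"
    and h_mult: "\<And>a b. h (a * b) = h a * h b" and h_1: "h 1 = 1"
begin

lemma h_0: "h 0 = 0"
  using h_add[of 0 0] by simp

lemma poly_eval_add: "poly_eval h x (f + g) = poly_eval h x f + poly_eval h x g"
  unfolding poly_eval_def
  by (rule setsum_keys_plus_distrib) (simp_all add: h_0 h_add distrib_right)

lemma poly_eval_sum: "poly_eval h x (sum F A) = (\<Sum>a\<in>A. poly_eval h x (F a))"
  by (induction A rule: infinite_finite_induct) (simp_all add: poly_eval_add)

lemma poly_eval_single:
  "poly_eval h x (Poly_Mapping.single m c) =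
     h c * (\<Prod>v\<in>Poly_Mapping.keys m. x v ^ Poly_Mapping.lookup m v)"
  by (simp add: poly_eval_def h_0)

lemma monomial_add:
  fixes m n :: "'v \<Rightarrow>\<^sub>0 nat" and x :: "'v \<Rightarrow> 'r"
  shows "(\<Prod>v\<in>Poly_Mapping.keys (m + n). x v ^ Poly_Mapping.lookup (m + n) v) =
    (\<Prod>v\<in>Poly_Mapping.keys m. x v ^ Poly_Mapping.lookup m v) *
    (\<Prod>v\<in>Poly_Mapping.keys n. x v ^ Poly_Mapping.lookup n v)"
proof -
  let ?A = "Poly_Mapping.keys m \<union> Poly_Mapping.keys n"
  have *: "(\<Prod>v\<in>Poly_Mapping.keys k. x v ^ Poly_Mapping.lookup k v) =
      (\<Prod>v\<in>?A. x v ^ Poly_Mapping.lookup k v)" if "Poly_Mapping.keys k \<subseteq> ?A" for k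
    by (rule prod.mono_neutral_left) (use that in \<open>auto simp: in_keys_iff\<close>)
  have "(\<Prod>v\<in>Poly_Mapping.keys (m + n). x v ^ Poly_Mapping.lookup (m + n) v) =
      (\<Prod>v\<in>?A. x v ^ Poly_Mapping.lookup (m + n) v)"
    by (rule *) (rule keys_add)
  then show ?thesis
    by (simp add: * lookup_add power_add prod.distrib)
qed

lemma poly_as_sum: "f = (\<Sum>m\<in>Poly_Mapping.keys f. Poly_Mapping.single m (Poly_Mapping.lookup f m))"
  by (rule poly_mapping_eqI)
    (simp add: lookup_sum lookup_single when_def in_keys_iff)

lemma poly_eval_mult: "poly_eval h x (f * g) = poly_eval h x f * poly_eval h x g"
proof -
  let ?e = "poly_eval h x" and ?s = "\<lambda>f m. Poly_Mapping.single m (Poly_Mapping.lookup f m)"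
  have ss: "?e (Poly_Mapping.single m c * Poly_Mapping.single n d) =
      ?e (Poly_Mapping.single m c) * ?e (Poly_Mapping.single n d)" for m n c d
    by (simp add: mult_single poly_eval_single monomial_add h_mult mult_ac)
  have "?e (f * g) = ?e ((\<Sum>m\<in>Poly_Mapping.keys f. ?s f m) * (\<Sum>n\<in>Poly_Mapping.keys g. ?s g n))"
    by (simp flip: poly_as_sum)
  also have "\<dots> = (\<Sum>m\<in>Poly_Mapping.keys f. \<Sum>n\<in>Poly_Mapping.keys g. ?e (?s f m) * ?e (?s g n))"
    by (simp add: sum_product poly_eval_sum ss)
  also have "\<dots> = ?e (\<Sum>m\<in>Poly_Mapping.keys f. ?s f m) * ?e (\<Sum>n\<in>Poly_Mapping.keys g. ?s g n)"
    by (simp add: sum_product poly_eval_sum)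
  finally show ?thesis
    by (simp flip: poly_as_sum)
qed

lemma poly_eval_1: "poly_eval h x 1 = 1"
  by (simp add: poly_eval_single h_1 flip: single_one)

lemma poly_eval_uminus: "poly_eval h x (- f) = - poly_eval h x f"
  using poly_eval_add[of x f "- f"] by (simp add: eq_neg_iff_add_eq_0 add.commute)

lemma poly_eval_diff: "poly_eval h x (f - g) = poly_eval h x f - poly_eval h x g"
  using poly_eval_add[of x f "- g"] by (simp add: poly_eval_uminus)

lemma poly_eval_mvar: "poly_eval h x (mvar v) = x v"
  by (simp add: mvar_def poly_eval_single h_1)

lemma poly_eval_mconst: "poly_eval h x (mconst c) = h c"
  by (simp add: mconst_def poly_eval_single)

end

lemma mconst_hom:
  "mconst (a + b) = mconst a + mconst b" "mconst (a * b) = mconst a * mconst b" "mconst 1 = 1"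
  by (simp_all add: mconst_def single_add mult_single)

lemmas poly_eval_mconst_hom =
  poly_eval_add[of mconst, OF mconst_hom] poly_eval_mult[of mconst, OF mconst_hom]
  poly_eval_1[of mconst, OF mconst_hom] poly_eval_uminus[of mconst, OF mconst_hom]
  poly_eval_diff[of mconst, OF mconst_hom] poly_eval_mvar[of mconst, OF mconst_hom]
  poly_eval_mconst[of mconst, OF mconst_hom]

lemma poly_eval_hom_poly_eval:
  fixes k :: "'r::comm_ring_1 \<Rightarrow> 's::comm_ring_1"
  assumes "k 0 = 0" "k 1 = 1" "\<And>a b. k (a + b) = k a + k b" "\<And>a b. k (a * b) = k a * k b"
  shows "k (poly_eval h x f) = poly_eval (\<lambda>c. k (h c)) (\<lambda>v. k (x v)) f"
proof -
  have s: "k (sum F A) = (\<Sum>a\<in>A. k (F a))" for F :: "('c \<Rightarrow>\<^sub>0 nat) \<Rightarrow> 'r" and A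
    by (induction A rule: infinite_finite_induct) (simp_all add: assms)
  have e: "k (a ^ n) = k a ^ n" for a and n :: nat
    by (induction n) (simp_all add: assms)
  have p: "k (prod F A) = (\<Prod>a\<in>A. k (F a))" for F :: "'c \<Rightarrow> 'r" and A
    by (induction A rule: infinite_finite_induct) (simp_all add: assms)
  show ?thesis
    by (simp add: poly_eval_def s p e assms)
qed

lemma ring_of_type_algebra_simps [simp]:
  "carrier ring_of_type_algebra = UNIV" "x \<otimes>\<^bsub>ring_of_type_algebra\<^esub> y = x * y"
  "x \<oplus>\<^bsub>ring_of_type_algebra\<^esub> y = x + y" "\<one>\<^bsub>ring_of_type_algebra\<^esub> = 1" "\<zero>\<^bsub>ring_of_type_algebra\<^esub> = 0"
  by (simp_all add: ring_of_type_algebra_def)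

lemma ring_of_type_algebra_minus [simp]:
  fixes x y :: "'r::comm_ring_1"
  shows "\<ominus>\<^bsub>ring_of_type_algebra\<^esub> x = - x" "x \<ominus>\<^bsub>ring_of_type_algebra\<^esub> y = x - y"
proof -
  interpret ring "ring_of_type_algebra :: 'r ring" by (rule ring_from_type_algebra)
  have *: "\<ominus>\<^bsub>ring_of_type_algebra\<^esub> x = - x" for x :: 'r
    by (rule minus_equality) simp_all
  show "\<ominus>\<^bsub>ring_of_type_algebra\<^esub> x = - x" "x \<ominus>\<^bsub>ring_of_type_algebra\<^esub> y = x - y"
    by (simp_all add: * a_minus_def)
qed

lemma coset_eq_iff:
  fixes J :: "'r::comm_ring_1 set"
  assumes "ideal J ring_of_type_algebra"
  shows "J +>\<^bsub>ring_of_type_algebra\<^esub> a = J +>\<^bsub>ring_of_type_algebra\<^esub> b \<longleftrightarrow> a - b \<in> J"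
  using ring.quotient_eq_iff_same_a_r_cos[OF ring_from_type_algebra assms, of a b] by simp

lemma genideal_type_algebra: "ideal (Idl\<^bsub>ring_of_type_algebra\<^esub> A) ring_of_type_algebra"
  for A :: "'r::comm_ring_1 set"
  by (rule ring.genideal_ideal[OF ring_from_type_algebra]) simp

lemma ideal_closed:
  fixes J :: "'r::comm_ring_1 set"
  assumes "ideal J ring_of_type_algebra"
  shows "0 \<in> J" "a \<in> J \<Longrightarrow> b \<in> J \<Longrightarrow> a + b \<in> J" "a \<in> J \<Longrightarrow> c * a \<in> J" "a \<in> J \<Longrightarrow> a * c \<in> J"
    "a \<in> J \<Longrightarrow> - a \<in> J" "a \<in> J \<Longrightarrow> b \<in> J \<Longrightarrow> a - b \<in> J"
proof -
  note s = ideal.axioms(1)[OF assms]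
  show z: "0 \<in> J" using additive_subgroup.zero_closed[OF s] by simp
  show p: "a \<in> J \<Longrightarrow> b \<in> J \<Longrightarrow> a + b \<in> J" for a b
    using additive_subgroup.a_closed[OF s, of a b] by simp
  show l: "a \<in> J \<Longrightarrow> c * a \<in> J" for a c
    using ideal.I_l_closed[OF assms, of a c] by simp
  show "a \<in> J \<Longrightarrow> a * c \<in> J" for a c
    using l by (simp add: mult.commute)
  show m: "a \<in> J \<Longrightarrow> - a \<in> J" for a
    using l[of a "-1"] by simp
  show "a \<in> J \<Longrightarrow> b \<in> J \<Longrightarrow> a - b \<in> J" for a b
    using p[of a "- b"] m by simp
qed

lemma poly_eval_cong_ideal:
  fixes J :: "'r::comm_ring_1 set"
    and x y :: "'v \<Rightarrow> 'r"
  assumes J: "ideal J ring_of_type_algebra" and xy: "\<And>v. x v - y v \<in> J"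
  shows "poly_eval h x f - poly_eval h y f \<in> J"
proof -
  note c = ideal_closed[OF J]
  have mult: "a * b - a' * b' \<in> J" if "a - a' \<in> J" "b - b' \<in> J" for a b a' b' :: 'r
  proof -
    have "a * b - a' * b' = (a - a') * b + a' * (b - b')" by (simp add: algebra_simps)
    then show ?thesis using that c by metis
  qed
  have e: "x v ^ n - y v ^ n \<in> J" for v and n :: nat
    by (induction n) (simp_all add: c(1) mult xy)
  have p: "(\<Prod>v\<in>A. x v ^ n v) - (\<Prod>v\<in>A. y v ^ n v) \<in> J" for A and n :: "'v \<Rightarrow> nat"
    by (induction A rule: infinite_finite_induct) (simp_all add: c(1) mult e)
  have s: "(\<Sum>a\<in>A. F a) - (\<Sum>a\<in>A. G a) \<in> J" if "\<And>a. F a - G a \<in> J"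
    for A and F G :: "('v \<Rightarrow>\<^sub>0 nat) \<Rightarrow> 'r"
    unfolding sum_subtractf[symmetric]
    by (induction A rule: infinite_finite_induct) (simp_all add: c(1,2) that)
  show ?thesis
    unfolding poly_eval_def by (rule s, rule mult) (simp_all add: c(1) p)
qed

lemma mat2_simps [simp]:
  "mat2 a b c d $ 1 $ 1 = a" "mat2 a b c d $ 1 $ 2 = b"
  "mat2 a b c d $ 2 $ 1 = c" "mat2 a b c d $ 2 $ 2 = d"
  by (simp_all add: mat2_def)

lemma gnn_ideal: "ideal gnn_ideal ring_of_type_algebra"
  and bgnn_ideal: "ideal bgnn_ideal ring_of_type_algebra"
  by (simp_all add: gnn_ideal_def bgnn_ideal_def genideal_type_algebra)

lemma bgnn_ideal_gens:
  "mvar (Inl B11) * mvar (Inl B22) - 1 \<in> (bgnn_ideal :: (b_var + gnn_var, 'a::field) mpoly set)"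
  "mvar (Inr G11) * mvar (Inr G22) - mvar (Inr G12) * mvar (Inr G21) - 1
     \<in> (bgnn_ideal :: (b_var + gnn_var, 'a) mpoly set)"
  using ring.genideal_self[OF ring_from_type_algebra, of
    "{det (mat_b (\<lambda>v. mvar (Inl v) :: (b_var + gnn_var, 'a::field) mpoly)) - 1,
      det (mat_g (\<lambda>v. mvar (Inr v))) - 1}"]
  by (simp_all add: bgnn_ideal_def det_2 mat_b_def mat_g_def)

lemma ideal_preimage:
  fixes k :: "'r::comm_ring_1 \<Rightarrow> 's::comm_ring_1"
  assumes k: "k 0 = 0" "\<And>a b. k (a + b) = k a + k b" "\<And>a b. k (a * b) = k a * k b"
    and J: "ideal J ring_of_type_algebra"
  shows "ideal {a. k a \<in> J} ring_of_type_algebra"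
proof -
  note c = ideal_closed[OF J]
  interpret ring "ring_of_type_algebra :: 'r ring" by (rule ring_from_type_algebra)
  have "k (- a) = - k a" for a using k(2)[of a "- a"] k(1) by (simp add: eq_neg_iff_add_eq_0 add.commute)
  then show ?thesis
    using k(1) by (intro idealI ring_axioms add.subgroupI)
      (auto simp: k(2,3) c(1-5) simp flip: a_inv_def intro: exI[of _ 0])
qed

text \<open>The two pullbacks are well defined on cosets.\<close>

lemma act_pullback_gnn_ideal: "f \<in> gnn_ideal \<Longrightarrow> act_pullback f \<in> bgnn_ideal"
  and pr_pullback_gnn_ideal: "f \<in> gnn_ideal \<Longrightarrow> pr_pullback f \<in> bgnn_ideal"
proof -
  let ?v = "\<lambda>v. mvar v :: (b_var + gnn_var, 'a) mpoly"
  note c = ideal_closed[OF bgnn_ideal]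
  have *: "poly_eval mconst x f \<in> bgnn_ideal"
    if "x G11 * x G22 - x G12 * x G21 - 1 \<in> bgnn_ideal" and "f \<in> gnn_ideal"
    for f :: "(gnn_var, 'a) mpoly" and x :: "gnn_var \<Rightarrow> (b_var + gnn_var, 'a) mpoly"
  proof -
    have "gnn_ideal \<subseteq> {f. poly_eval mconst x f \<in> bgnn_ideal}"
      unfolding gnn_ideal_def
      by (intro ring.genideal_minimal ring_from_type_algebra ideal_preimage bgnn_ideal)
        (use that in \<open>simp_all add: poly_eval_mconst_hom det_2 mat_g_def\<close>)
    with that show ?thesis by blast
  qed
  have "act_coords (\<lambda>v. ?v (Inr v)) (\<lambda>v. ?v (Inl v)) G11 * act_coords (\<lambda>v. ?v (Inr v)) (\<lambda>v. ?v (Inl v)) G22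
      - act_coords (\<lambda>v. ?v (Inr v)) (\<lambda>v. ?v (Inl v)) G12 * act_coords (\<lambda>v. ?v (Inr v)) (\<lambda>v. ?v (Inl v)) G21 - 1
    = (?v (Inr G11) * ?v (Inr G22) - ?v (Inr G12) * ?v (Inr G21) - 1) * (?v (Inl B11) * ?v (Inl B22))
      + (?v (Inl B11) * ?v (Inl B22) - 1)"
    by (simp add: act_coords_def gnn_coords_def matrix_matrix_mult_def sum_2 mat_g_def mat_b_def
      algebra_simps)
  also have "\<dots> \<in> bgnn_ideal" by (rule c(2)[OF c(4)[OF bgnn_ideal_gens(2)] bgnn_ideal_gens(1)])
  finally show "act_pullback f \<in> bgnn_ideal" if "f \<in> gnn_ideal" for f :: "(gnn_var, 'a) mpoly"
    unfolding act_pullback_def using that by (rule *)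
  show "pr_pullback f \<in> bgnn_ideal" if "f \<in> gnn_ideal" for f :: "(gnn_var, 'a) mpoly"
    unfolding pr_pullback_def using bgnn_ideal_gens(2) that by (rule *)
qed

lemma p_coords_act_coords:
  "p_coords (act_coords z y) v - p_coords z v =
    (y B11 * y B22 - 1) * ((y B11 * y B22 + 1) * p_coords z v)"
  by (cases v) (simp_all add: p_coords_def gg_coords_def act_coords_def gnn_coords_def Ad_def
      adj2_def matrix_matrix_mult_def sum_2 mat_g_def mat_b_def nil_M_def nil_N_def algebra_simps)

lemma p_sharp_invariant:
  fixes f :: "(gg_var, 'a::field) mpoly"
  shows "act_pullback (poly_eval mconst (p_coords mvar) f) - pr_pullback (poly_eval mconst (p_coords mvar) f)
    \<in> bgnn_ideal"
proof -
  let ?z = "\<lambda>v. mvar (Inr v) :: (b_var + gnn_var, 'a) mpoly"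
    and ?y = "\<lambda>v. mvar (Inl v) :: (b_var + gnn_var, 'a) mpoly"
  note c = ideal_closed[OF bgnn_ideal]
  have comp: "poly_eval mconst x (poly_eval mconst (p_coords mvar) f) = poly_eval mconst (p_coords x) f"
    for x :: "gnn_var \<Rightarrow> (b_var + gnn_var, 'a) mpoly"
  proof -
    have "poly_eval mconst x (p_coords mvar v) = p_coords x v" for v
      by (simp add: p_coords_def gg_coords_def Ad_def adj2_def matrix_matrix_mult_def sum_2 mat_g_def
        nil_M_def nil_N_def poly_eval_mconst_hom split: gg_var.split)
    then show ?thesis
      by (subst poly_eval_hom_poly_eval[where k = "poly_eval mconst x"])
        (simp_all add: poly_eval_mconst_hom)
  qed
  have "p_coords (act_coords ?z ?y) v - p_coords ?z v \<in> bgnn_ideal" for v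
    unfolding p_coords_act_coords by (rule c(4)[OF bgnn_ideal_gens(1)])
  then show ?thesis
    unfolding act_pullback_def pr_pullback_def comp
    by (rule poly_eval_cong_ideal[OF bgnn_ideal])
qed

lemma cring_H0_Y: "cring (H0_Y :: (gnn_var, 'a::field) mpoly set ring)"
proof -
  let ?P = "ring_of_type_algebra :: (gnn_var, 'a) mpoly ring"
  let ?Q = "?P Quot gnn_ideal"
  let ?inv = "\<lambda>f :: (gnn_var, 'a) mpoly. act_pullback f - pr_pullback f \<in> bgnn_ideal"
  let ?C = "{gnn_ideal +>\<^bsub>?P\<^esub> f | f. ?inv f}"
  note c = ideal_closed[OF bgnn_ideal]
  interpret I: ideal gnn_ideal ?P by (rule gnn_ideal)
  interpret Q: cring ?Q by (rule I.quotient_is_cring) (rule cring_from_type_algebra)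
  interpret h: ring_hom_ring ?P ?Q "(+>\<^bsub>?P\<^esub>) gnn_ideal" by (rule I.rcos_ring_hom_ring)
  have inv: "?inv 1" "?inv f \<Longrightarrow> ?inv (- f)" "?inv f \<Longrightarrow> ?inv g \<Longrightarrow> ?inv (f + g)"
    "?inv f \<Longrightarrow> ?inv g \<Longrightarrow> ?inv (f * g)" for f g
  proof -
    note simps = act_pullback_def pr_pullback_def poly_eval_mconst_hom
    show "?inv 1" using c(1) by (simp add: simps)
    show "?inv (- f)" if "?inv f" using c(5)[OF that] by (simp add: simps)
    show "?inv (f + g)" if "?inv f" "?inv g"
      using c(2)[OF that] by (simp add: simps algebra_simps)
    show "?inv (f * g)" if "?inv f" "?inv g"
      using c(2)[OF c(4)[OF that(1), of "act_pullback g"] c(3)[OF that(2), of "pr_pullback f"]]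
      by (simp add: simps algebra_simps)
  qed
  have hom: "gnn_ideal +>\<^bsub>?P\<^esub> (f * g) = (gnn_ideal +>\<^bsub>?P\<^esub> f) \<otimes>\<^bsub>?Q\<^esub> (gnn_ideal +>\<^bsub>?P\<^esub> g)"
    "gnn_ideal +>\<^bsub>?P\<^esub> (f + g) = (gnn_ideal +>\<^bsub>?P\<^esub> f) \<oplus>\<^bsub>?Q\<^esub> (gnn_ideal +>\<^bsub>?P\<^esub> g)"
    "gnn_ideal +>\<^bsub>?P\<^esub> (- f) = \<ominus>\<^bsub>?Q\<^esub> (gnn_ideal +>\<^bsub>?P\<^esub> f)"
    "gnn_ideal +>\<^bsub>?P\<^esub> 1 = \<one>\<^bsub>?Q\<^esub>" "gnn_ideal +>\<^bsub>?P\<^esub> f \<in> carrier ?Q" for f g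
    using h.hom_mult[of f g] h.hom_add[of f g] h.hom_a_inv[of f] h.hom_one h.hom_closed[of f]
    by simp_all
  have "subring ?C ?Q"
  proof (rule Q.subringI)
    show "?C \<subseteq> carrier ?Q" using hom(5) by blast
    show "\<one>\<^bsub>?Q\<^esub> \<in> ?C" using hom(4) inv(1) by blast
    show "\<ominus>\<^bsub>?Q\<^esub> x \<in> ?C" if x: "x \<in> ?C" for x
    proof -
      obtain f where "x = gnn_ideal +>\<^bsub>?P\<^esub> f" "?inv f" using x by blast
      then show ?thesis using inv(2)[of f] hom(3)[of f, symmetric] by blast
    qed
    fix x y assume xy: "x \<in> ?C" "y \<in> ?C"
    then obtain f g where f: "x = gnn_ideal +>\<^bsub>?P\<^esub> f" "?inv f"
      and g: "y = gnn_ideal +>\<^bsub>?P\<^esub> g" "?inv g" by blast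
    show "x \<otimes>\<^bsub>?Q\<^esub> y \<in> ?C" unfolding f(1) g(1) hom(1)[symmetric] using inv(4)[OF f(2) g(2)] by blast
    show "x \<oplus>\<^bsub>?Q\<^esub> y \<in> ?C" unfolding f(1) g(1) hom(2)[symmetric] using inv(3)[OF f(2) g(2)] by blast
  qed
  then have "cring (?Q\<lparr>carrier := ?C\<rparr>)"
    by (intro Q.subcring_iff[THEN iffD1] Q.subcringI' subringE(1))
  then show ?thesis
    by (simp add: H0_Y_def coset_eq_iff[OF bgnn_ideal])
qed

lemma p_sharp_hom: "p_sharp \<in> ring_hom S_ring H0_Y"
proof -
  let ?P = "ring_of_type_algebra :: (gnn_var, 'a) mpoly ring"
  interpret I: ideal gnn_ideal ?P by (rule gnn_ideal)
  interpret h: ring_hom_ring ?P "?P Quot gnn_ideal" "(+>\<^bsub>?P\<^esub>) gnn_ideal"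
    by (rule I.rcos_ring_hom_ring)
  have "p_sharp f \<in> carrier H0_Y" for f :: "(gg_var, 'a) mpoly"
    using p_sharp_invariant[of f] by (auto simp: p_sharp_def H0_Y_def coset_eq_iff[OF bgnn_ideal])
  moreover have "gnn_ideal +>\<^bsub>?P\<^esub> (f * g) = (gnn_ideal +>\<^bsub>?P\<^esub> f) \<otimes>\<^bsub>?P Quot gnn_ideal\<^esub> (gnn_ideal +>\<^bsub>?P\<^esub> g)"
    "gnn_ideal +>\<^bsub>?P\<^esub> (f + g) = (gnn_ideal +>\<^bsub>?P\<^esub> f) \<oplus>\<^bsub>?P Quot gnn_ideal\<^esub> (gnn_ideal +>\<^bsub>?P\<^esub> g)"
    "gnn_ideal +>\<^bsub>?P\<^esub> 1 = \<one>\<^bsub>?P Quot gnn_ideal\<^esub>" for f g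
    using h.hom_mult[of f g] h.hom_add[of f g] h.hom_one by simp_all
  ultimately show ?thesis
    by (intro ring_hom_memI) (simp_all add: S_ring_def p_sharp_def H0_Y_def poly_eval_mconst_hom)
qed

end

theory Submission
  imports Defs
begin

text \<open>On the chart \<open>g = [[1, 0], [- t, 1]]\<close> of \<open>G/B\<close>, the pair \<open>x E\<^sub>1\<^sub>2, y E\<^sub>1\<^sub>2\<close> goes to matrices whose entries
  are, up to sign, \<open>x, x t, x t\<^sup>2\<close> and \<open>y, y t, y t\<^sup>2\<close>, so the kernel consists of polynomials that vanish
  after this monomial substitution. Since \<open>2\<close> is invertible, the given equations generate the \<open>2 \<times> 2\<close>
  minors of \<open>[[M12, M11, N12, N11], [M11, - M21, N11, - N21]]\<close>, the equations of the rational normal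
  scroll \<open>S(2,2)\<close>. Modulo these, multiplying a standard monomial by a variable gives, up to sign, a
  standard monomial again, so every polynomial is congruent to a combination of standard monomials.
  Distinct standard monomials have distinct images \<open>x\<^sup>k y\<^sup>l t\<^sup>j\<close>, so this combination is determined by
  the image and is \<open>0\<close> for elements of the kernel.\<close>

section \<open>Standard monomials\<close>

text \<open>The preimage of \<open>x\<^sup>k y\<^sup>l t\<^sup>j\<close> (for \<open>j \<le> 2 (k + l)\<close>) under
  \<open>(b, a, c, e, d, f) \<mapsto> (x, x t, x t\<^sup>2, y, y t, y t\<^sup>2)\<close> that puts as much of \<open>t\<^sup>j\<close> as possible into the
  first three factors.\<close>

fun std_monom :: "'r::comm_ring_1 \<Rightarrow> 'r \<Rightarrow> 'r \<Rightarrow> 'r \<Rightarrow> 'r \<Rightarrow> 'r \<Rightarrow> nat \<times> nat \<times> nat \<Rightarrow> 'r"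
  where "std_monom b a c e d f (k, l, j) =
    (if j \<le> 2 * k then b ^ (k - (j + 1) div 2) * a ^ (j mod 2) * c ^ (j div 2) * e ^ l
     else c ^ k * e ^ (l - (j - 2 * k + 1) div 2) * d ^ ((j - 2 * k) mod 2) * f ^ ((j - 2 * k) div 2))"

text \<open>Splitting by the parity of \<open>j\<close> and by the branch removes
  \<open>div\<close>, \<open>mod\<close> and truncated subtraction. The third family at
  \<open>i = 0\<close> is the boundary \<open>j = 2 * k\<close>, which falls in the first branch;
  hence the case split on \<open>i\<close>.\<close>

lemma std_monom_families:
  "std_monom b a c e d f (i + n, l, 2 * i) = b ^ n * c ^ i * e ^ l"
  "std_monom b a c e d f (i + n + 1, l, 2 * i + 1) = b ^ n * a * c ^ i * e ^ l"
  "std_monom b a c e d f (k, i + n, 2 * k + 2 * i) = c ^ k * e ^ n * f ^ i"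
  "std_monom b a c e d f (k, i + n + 1, 2 * k + 2 * i + 1) = c ^ k * e ^ n * d * f ^ i"
  by (simp_all, (cases i; simp)?)

text \<open>The boundary \<open>j = 2 * k\<close> belongs to case 1, so case 3 starts at
  \<open>Suc i\<close> and always has a factor \<open>f\<close> to trade.\<close>

lemma std_monom_cases:
  assumes "j \<le> 2 * (k + l)"
  obtains (1) i n where "k = i + n" "j = 2 * i"
  | (2) i n where "k = i + n + 1" "j = 2 * i + 1"
  | (3) i n where "l = Suc i + n" "j = 2 * k + 2 * Suc i"
  | (4) i n where "l = i + n + 1" "j = 2 * k + 2 * i + 1"
proof (cases "j \<le> 2 * k")
  case True
  show ?thesis
  proof (cases "even j")
    case True
    with \<open>j \<le> 2 * k\<close> show ?thesis using 1[of "j div 2" "k - j div 2"] by auto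
  next
    case False
    with \<open>j \<le> 2 * k\<close> show ?thesis using 2[of "j div 2" "k - j div 2 - 1"] by (auto elim!: oddE)
  qed
next
  case False
  show ?thesis
  proof (cases "even j")
    case True
    with False assms show ?thesis
      using 3[of "j div 2 - k - 1" "k + l - j div 2"] by (auto elim!: evenE)
  next
    case odd: False
    with False assms show ?thesis
      using 4[of "j div 2 - k" "k + l - j div 2 - 1"] by (auto elim!: oddE)
  qed
qed

text \<open>Either the product is literally the next standard monomial, or a multiple of a single
  minor turns it into one by moving a power of \<open>t\<close> towards the first three factors. The
  term given to \<open>r\<close> is the cofactor of that minor.\<close>

lemma std_monom_step:
  fixes J :: "'r::comm_ring_1 set"
  assumes J: "ideal J ring_of_type_algebra"
    and rel: "a * a - b * c \<in> J" "d * d - e * f \<in> J" "b * d - a * e \<in> J"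
      "a * f - c * d \<in> J" "b * f - c * e \<in> J" "a * d - c * e \<in> J"
    and j: "j \<le> 2 * (k + l)"
  defines "s \<equiv> \<lambda>k l j. std_monom b a c e d f (k, l, j)"
  shows "b * s k l j - s (k + 1) l j \<in> J" (is ?b)
    "a * s k l j - s (k + 1) l (j + 1) \<in> J" (is ?a)
    "c * s k l j - s (k + 1) l (j + 2) \<in> J" (is ?c)
    "e * s k l j - s k (l + 1) j \<in> J" (is ?e)
    "d * s k l j - s k (l + 1) (j + 1) \<in> J" (is ?d)
    "f * s k l j - s k (l + 1) (j + 2) \<in> J" (is ?f)
proof -
  note r = rel[THEN ideal_closed(4)[OF J]]
  have eqI: "x - y \<in> J" if "x = y" for x y using that ideal_closed(1)[OF J] by simp
  have mem: "x \<in> J" if "y \<in> J" "x = y" for x y using that by simp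
  note fam = std_monom_families[of b a c e d f]
  from j have "?b \<and> ?a \<and> ?c \<and> ?e \<and> ?d \<and> ?f"
  proof (cases rule: std_monom_cases)
    case (1 i n)
    have s: "s k l j = b ^ n * c ^ i * e ^ l" unfolding s_def 1 by (rule fam)
    have b: ?b unfolding s using fam(1)[of i "n + 1" l] by (intro eqI) (simp add: s_def 1 mult_ac)
    have a: ?a unfolding s using fam(2)[of i n l] by (intro eqI) (simp add: s_def 1 mult_ac)
    have c: ?c unfolding s using fam(1)[of "i + 1" n l] by (intro eqI) (simp add: s_def 1 mult_ac)
    have e: ?e unfolding s using fam(1)[of i n "l + 1"] by (intro eqI) (simp add: s_def 1 mult_ac)
    \<comment> \<open>For \<open>n = 0\<close> the first three factors already carry the maximal
      power of \<open>t\<close>, so the new one stays with \<open>d\<close>; otherwise a factor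
      \<open>b\<close> absorbs it through \<open>b d = a e\<close>.\<close>
    have d: ?d
    proof (cases n)
      case 0
      show ?thesis unfolding s using fam(4)[of i 0 l] by (intro eqI) (simp add: s_def 1 0 mult_ac)
    next
      case (Suc m)
      show ?thesis unfolding s using fam(2)[of i m "l + 1"]
        by (intro mem[OF r(3)[of "b ^ m * c ^ i * e ^ l"]]) (simp add: s_def 1 Suc algebra_simps)
    qed
    have f: ?f
    proof (cases n)
      case 0
      show ?thesis unfolding s using fam(3)[of i 1 l] by (intro eqI) (simp add: s_def 1 0 mult_ac)
    next
      case (Suc m)
      show ?thesis unfolding s using fam(1)[of "i + 1" m "l + 1"]
        by (intro mem[OF r(5)[of "b ^ m * c ^ i * e ^ l"]]) (simp add: s_def 1 Suc algebra_simps)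
    qed
    show ?thesis using a b c d e f by blast
  next
    case (2 i n)
    have s: "s k l j = b ^ n * a * c ^ i * e ^ l" unfolding s_def 2 by (rule fam)
    have b: ?b unfolding s using fam(2)[of i "n + 1" l] by (intro eqI) (simp add: s_def 2 mult_ac)
    have a: ?a unfolding s using fam(1)[of "i + 1" "n + 1" l]
      by (intro mem[OF r(1)[of "b ^ n * c ^ i * e ^ l"]]) (simp add: s_def 2 algebra_simps)
    have c: ?c unfolding s using fam(2)[of "i + 1" n l] by (intro eqI) (simp add: s_def 2 mult_ac)
    have e: ?e unfolding s using fam(2)[of i n "l + 1"] by (intro eqI) (simp add: s_def 2 mult_ac)
    have d: ?d unfolding s using fam(1)[of "i + 1" n "l + 1"]
      by (intro mem[OF r(6)[of "b ^ n * c ^ i * e ^ l"]]) (simp add: s_def 2 algebra_simps)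
    \<comment> \<open>For \<open>n = 0\<close> only \<open>a\<close> has room, for a single
      \<open>t\<close>: \<open>a f = c d\<close> leaves the other one with \<open>d\<close>.\<close>
    have f: ?f
    proof (cases n)
      case 0
      show ?thesis unfolding s using fam(4)[of "i + 1" 0 l]
        by (intro mem[OF r(4)[of "c ^ i * e ^ l"]]) (simp add: s_def 2 0 algebra_simps)
    next
      case (Suc m)
      show ?thesis unfolding s using fam(2)[of "i + 1" m "l + 1"]
        by (intro mem[OF r(5)[of "b ^ m * a * c ^ i * e ^ l"]]) (simp add: s_def 2 Suc algebra_simps)
    qed
    show ?thesis using a b c d e f by blast
  next
    case (3 i n)
    have s: "s k l j = c ^ k * e ^ n * f ^ Suc i" unfolding s_def 3 by (rule fam)
    \<comment> \<open>The new factor \<open>b\<close> or \<open>a\<close> is not saturated, so it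
      draws two or one powers of \<open>t\<close> from an \<open>f\<close>.\<close>
    have b: ?b unfolding s using fam(3)[of "k + 1" i "n + 1"]
      by (intro mem[OF r(5)[of "c ^ k * e ^ n * f ^ i"]]) (simp add: s_def 3 algebra_simps)
    have a: ?a unfolding s using fam(4)[of "k + 1" i n]
      by (intro mem[OF r(4)[of "c ^ k * e ^ n * f ^ i"]]) (simp add: s_def 3 algebra_simps)
    have c: ?c unfolding s using fam(3)[of "k + 1" "Suc i" n] by (intro eqI) (simp add: s_def 3 mult_ac)
    have e: ?e unfolding s using fam(3)[of k "Suc i" "n + 1"] by (intro eqI) (simp add: s_def 3 mult_ac)
    have d: ?d unfolding s using fam(4)[of k "Suc i" n] by (intro eqI) (simp add: s_def 3 mult_ac)
    have f: ?f unfolding s using fam(3)[of k "Suc i + 1" n] by (intro eqI) (simp add: s_def 3 mult_ac)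
    show ?thesis using a b c d e f by blast
  next
    case (4 i n)
    have s: "s k l j = c ^ k * e ^ n * d * f ^ i" unfolding s_def 4 by (rule fam)
    \<comment> \<open>Without an \<open>f\<close>, the only \<open>t\<close> to draw on sits in
      \<open>d\<close>, and \<open>b d = a e\<close> leads back into the first branch.\<close>
    have b: ?b
    proof (cases i)
      case 0
      show ?thesis unfolding s using fam(2)[of k 0 "n + 1"]
        by (intro mem[OF r(3)[of "c ^ k * e ^ n"]]) (simp add: s_def 4 0 algebra_simps)
    next
      case (Suc m)
      show ?thesis unfolding s using fam(4)[of "k + 1" m "n + 1"]
        by (intro mem[OF r(5)[of "c ^ k * e ^ n * d * f ^ m"]]) (simp add: s_def 4 Suc algebra_simps)
    qed
    have a: ?a unfolding s using fam(3)[of "k + 1" i "n + 1"]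
      by (intro mem[OF r(6)[of "c ^ k * e ^ n * f ^ i"]]) (simp add: s_def 4 algebra_simps)
    have c: ?c unfolding s using fam(4)[of "k + 1" i n] by (intro eqI) (simp add: s_def 4 mult_ac)
    have e: ?e unfolding s using fam(4)[of k i "n + 1"] by (intro eqI) (simp add: s_def 4 mult_ac)
    have d: ?d unfolding s using fam(3)[of k "i + 1" "n + 1"]
      by (intro mem[OF r(2)[of "c ^ k * e ^ n * f ^ i"]]) (simp add: s_def 4 algebra_simps)
    have f: ?f unfolding s using fam(4)[of k "i + 1" n] by (intro eqI) (simp add: s_def 4 mult_ac)
    show ?thesis using a b c d e f by blast
  qed
  then show ?b ?a ?c ?e ?d ?f by blast+
qed

section \<open>The ideal of the relations\<close>

definition rel_ideal :: "(gg_var, 'a::field) mpoly set"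
  where "rel_ideal = Idl\<^bsub>S_ring\<^esub> ({det univ_M, det univ_N, trace (univ_M ** univ_N)} \<union>
    {(univ_M ** univ_N - univ_N ** univ_M)$i$j | i j. True})"

lemma ideal_rel_ideal: "ideal rel_ideal ring_of_type_algebra"
  unfolding rel_ideal_def S_ring_def by (rule genideal_type_algebra)

lemma rel_ideal_gens:
  defines "J \<equiv> rel_ideal :: (gg_var, 'a::field) mpoly set"
  shows "det univ_M \<in> J" "det univ_N \<in> J" "trace (univ_M ** univ_N) \<in> J"
    "(univ_M ** univ_N - univ_N ** univ_M)$i$j \<in> J"
  using ring.genideal_self[OF ring_from_type_algebra, of
    "{det univ_M, det univ_N, trace (univ_M ** univ_N)} \<union>
      {(univ_M ** univ_N - univ_N ** univ_M :: (gg_var, 'a::field) mpoly^2^2)$i$j | i j. True}"]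
  unfolding J_def rel_ideal_def S_ring_def by auto

text \<open>Stated for an arbitrary \<open>J\<close> to serve twice: \<open>gnn_ideal\<close> shows
  that the relations lie in the kernel, and \<open>{0}\<close> describes the points of the
  subscheme.\<close>

lemma poly_eval_rel_ideal_iff:
  fixes h :: "'a::field \<Rightarrow> 'r::comm_ring_1"
  assumes h: "\<And>a b. h (a + b) = h a + h b" "\<And>a b. h (a * b) = h a * h b" "h 1 = 1"
    and J: "ideal J ring_of_type_algebra"
  shows "(\<forall>f\<in>rel_ideal. poly_eval h x f \<in> J) \<longleftrightarrow>
    det (mat_M x) \<in> J \<and> det (mat_N x) \<in> J \<and> trace (mat_M x ** mat_N x) \<in> J \<and>
    (\<forall>i j. (mat_M x ** mat_N x - mat_N x ** mat_M x)$i$j \<in> J)"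
    (is "_ \<longleftrightarrow> ?R")
proof -
  let ?k = "poly_eval h x"
  note eval = poly_eval_add[of h, OF h] poly_eval_mult[of h, OF h] poly_eval_diff[of h, OF h]
  have entry: "?k (univ_M$i$j) = mat_M x$i$j" "?k (univ_N$i$j) = mat_N x$i$j" for i j
    using exhaust_2[of i] exhaust_2[of j]
    by (auto simp: univ_M_def univ_N_def mat_M_def mat_N_def poly_eval_uminus[of h, OF h]
      poly_eval_mvar[of h, OF h])
  have gens: "?k (det univ_M) = det (mat_M x)" "?k (det univ_N) = det (mat_N x)"
    "?k (trace (univ_M ** univ_N)) = trace (mat_M x ** mat_N x)"
    "?k ((univ_M ** univ_N - univ_N ** univ_M)$i$j) = (mat_M x ** mat_N x - mat_N x ** mat_M x)$i$j"
    for i j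
    by (simp_all only: det_2 trace_def sum_2 matrix_matrix_mult_def vec_lambda_beta
      vector_minus_component eval entry)
  show ?thesis
  proof
    assume ?R
    then have "rel_ideal \<subseteq> {f. ?k f \<in> J}"
      unfolding rel_ideal_def S_ring_def
      by (intro ring.genideal_minimal ring_from_type_algebra ideal_preimage poly_eval_0 eval(1,2) J)
        (auto simp only: gens mem_Collect_eq Un_iff insert_iff empty_iff)
    then show "\<forall>f\<in>rel_ideal. ?k f \<in> J" by blast
  next
    assume "\<forall>f\<in>rel_ideal. ?k f \<in> J"
    from this[THEN bspec, OF rel_ideal_gens(1)] this[THEN bspec, OF rel_ideal_gens(2)]
      this[THEN bspec, OF rel_ideal_gens(3)] this[THEN bspec, OF rel_ideal_gens(4)]
    show ?R unfolding gens by blast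
  qed
qed

lemma ideal_zero_type_algebra: "ideal {0 :: 'r::comm_ring_1} ring_of_type_algebra"
proof -
  have "ideal {\<zero>\<^bsub>ring_of_type_algebra :: 'r ring\<^esub>} ring_of_type_algebra"
    by (rule ring.zeroideal) (rule ring_from_type_algebra)
  then show ?thesis by simp
qed

lemma two_times_in_ideal:
  fixes J :: "('v, 'a::field) mpoly set"
  assumes "(2::'a) \<noteq> 0" and J: "ideal J ring_of_type_algebra" and "2 * f \<in> J"
  shows "f \<in> J"
proof -
  have "mconst (1 + 1) = (mconst 1 + mconst 1 :: ('v, 'a) mpoly)"
    by (rule mconst_hom(1))
  then have two: "2 = (mconst 2 :: ('v, 'a) mpoly)"
    by (simp add: mconst_hom(3))
  have "mconst (1 / 2) * (2 * f) = mconst (1 / 2 * 2) * f"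
    by (simp only: two mconst_hom(2) mult.assoc)
  also have "\<dots> = f"
    using assms(1) by (simp add: mconst_hom(3))
  finally show ?thesis using ideal_closed(3)[OF J assms(3), of "mconst (1 / 2)"] by simp
qed

text \<open>The determinants are the first two minors up to sign, the off-diagonal entries of the
  commutator are twice the next two up to sign, and its diagonal gives \<open>b f - c e\<close>. The
  trace is \<open>2 a d - b f - c e\<close>; adding \<open>b f - c e\<close> gives twice the last
  minor.\<close>

lemma rel_ideal_minors:
  assumes two: "(2::'a::field) \<noteq> 0"
  defines "b \<equiv> mvar M12" and "a \<equiv> mvar M11" and "c \<equiv> - mvar M21"
    and "e \<equiv> mvar N12" and "d \<equiv> mvar N11" and "f \<equiv> - mvar N21"
  shows "a * a - b * c \<in> (rel_ideal :: (gg_var, 'a) mpoly set)"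
    "d * d - e * f \<in> (rel_ideal :: (gg_var, 'a) mpoly set)"
    "b * d - a * e \<in> (rel_ideal :: (gg_var, 'a) mpoly set)"
    "a * f - c * d \<in> (rel_ideal :: (gg_var, 'a) mpoly set)"
    "b * f - c * e \<in> (rel_ideal :: (gg_var, 'a) mpoly set)"
    "a * d - c * e \<in> (rel_ideal :: (gg_var, 'a) mpoly set)"
proof -
  let ?J = "rel_ideal :: (gg_var, 'a) mpoly set"
  note J = ideal_rel_ideal and cl = ideal_closed[OF ideal_rel_ideal]
  note defs = b_def a_def c_def e_def d_def f_def
  note exp = univ_M_def univ_N_def mat_M_def mat_N_def det_2 matrix_matrix_mult_def sum_2 trace_def
  have comm: "(univ_M ** univ_N - univ_N ** univ_M)$i$j \<in> ?J" for i j by (rule rel_ideal_gens)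
  show "a * a - b * c \<in> ?J" "d * d - e * f \<in> ?J"
    using cl(5)[OF rel_ideal_gens(1)] cl(5)[OF rel_ideal_gens(2)]
    by (simp_all add: exp defs algebra_simps)
  have "2 * (b * d - a * e) \<in> ?J" "2 * (a * f - c * d) \<in> ?J"
    using cl(5)[OF comm[of 1 2]] comm[of 2 1] by (simp_all add: exp defs algebra_simps)
  then show "b * d - a * e \<in> ?J" "a * f - c * d \<in> ?J"
    using two_times_in_ideal[OF two J] by blast+
  show bf: "b * f - c * e \<in> ?J" using cl(5)[OF comm[of 1 1]] by (simp add: exp defs algebra_simps)
  have "2 * (a * d) - b * f - c * e \<in> ?J" using rel_ideal_gens(3) by (simp add: exp defs algebra_simps)
  from cl(2)[OF this bf] have "2 * (a * d - c * e) \<in> ?J" by (simp add: algebra_simps)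
  then show "a * d - c * e \<in> ?J" by (rule two_times_in_ideal[OF two J])
qed

section \<open>Restriction to the big cell\<close>

text \<open>The pullback of the coordinates to the chart \<open>g = [[1, 0], [- t, 1]]\<close> of \<open>G/B\<close>. The monomial
  with exponents \<open>(k, l, j)\<close> stands for \<open>x\<^sup>k y\<^sup>l t\<^sup>j\<close>, where \<open>x\<close> and \<open>y\<close> are the coordinates on \<open>\<nn> \<times> \<nn>\<close>.\<close>

definition cell_coords :: "gg_var \<Rightarrow> (nat \<times> nat \<times> nat) \<Rightarrow>\<^sub>0 'a::field"
  where "cell_coords v = (case v of
    M11 \<Rightarrow> Poly_Mapping.single (1, 0, 1) 1 | M12 \<Rightarrow> Poly_Mapping.single (1, 0, 0) 1
  | M21 \<Rightarrow> Poly_Mapping.single (1, 0, 2) (- 1) | N11 \<Rightarrow> Poly_Mapping.single (0, 1, 1) 1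
  | N12 \<Rightarrow> Poly_Mapping.single (0, 1, 0) 1 | N21 \<Rightarrow> Poly_Mapping.single (0, 1, 2) (- 1))"

definition cell_restrict :: "(gg_var, 'a::field) mpoly \<Rightarrow> (nat \<times> nat \<times> nat) \<Rightarrow>\<^sub>0 'a"
  where "cell_restrict = poly_eval (Poly_Mapping.single 0) cell_coords"

lemma single_0_hom:
  "Poly_Mapping.single (0::'m::comm_monoid_add) (a + b) = Poly_Mapping.single 0 a + Poly_Mapping.single 0 b"
  "Poly_Mapping.single (0::'m) (a * b) = Poly_Mapping.single 0 a * Poly_Mapping.single 0 (b::'a::comm_ring_1)"
  "Poly_Mapping.single (0::'m) (1::'a) = 1"
  by (simp_all add: single_add mult_single)

lemmas poly_eval_single_0_hom =
  poly_eval_add[of "Poly_Mapping.single 0", OF single_0_hom]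
  poly_eval_mult[of "Poly_Mapping.single 0", OF single_0_hom]
  poly_eval_1[of "Poly_Mapping.single 0", OF single_0_hom]
  poly_eval_uminus[of "Poly_Mapping.single 0", OF single_0_hom]
  poly_eval_diff[of "Poly_Mapping.single 0", OF single_0_hom]
  poly_eval_mvar[of "Poly_Mapping.single 0", OF single_0_hom]
  poly_eval_mconst[of "Poly_Mapping.single 0", OF single_0_hom]

lemma p_sharp_zero_imp_cell_restrict_zero:
  fixes f :: "(gg_var, 'a::field) mpoly"
  assumes "poly_eval mconst (p_coords mvar) f \<in> gnn_ideal"
  shows "cell_restrict f = 0"
proof -
  \<comment> \<open>The matrix of the chart has determinant 1, so evaluation at \<open>z\<close>
    kills \<open>gnn_ideal\<close>.\<close>
  define z :: "gnn_var \<Rightarrow> (nat \<times> nat \<times> nat) \<Rightarrow>\<^sub>0 'a" where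
    "z v = (case v of G11 \<Rightarrow> 1 | G12 \<Rightarrow> 0 | G21 \<Rightarrow> - Poly_Mapping.single (0, 0, 1) 1 | G22 \<Rightarrow> 1
      | XM \<Rightarrow> Poly_Mapping.single (1, 0, 0) 1 | XN \<Rightarrow> Poly_Mapping.single (0, 1, 0) 1)" for v
  let ?k = "poly_eval (Poly_Mapping.single 0) z"
  have "gnn_ideal \<subseteq> {f. ?k f \<in> {0}}"
    unfolding gnn_ideal_def
    by (intro ring.genideal_minimal ring_from_type_algebra ideal_preimage ideal_zero_type_algebra)
      (simp_all add: poly_eval_single_0_hom det_2 mat_g_def z_def)
  then have "?k (poly_eval mconst (p_coords mvar) f) = 0" using assms by blast
  moreover have "?k (p_coords mvar v) = cell_coords v" for v
    by (cases v) (simp_all add: p_coords_def gg_coords_def Ad_def adj2_def matrix_matrix_mult_def sum_2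
      mat_g_def nil_M_def nil_N_def poly_eval_single_0_hom z_def cell_coords_def mult_single single_uminus
      numeral_2_eq_2)
  ultimately show ?thesis
    unfolding cell_restrict_def
    by (subst (asm) poly_eval_hom_poly_eval[where k = ?k]) (simp_all add: poly_eval_single_0_hom)
qed

section \<open>Normal forms modulo the relations\<close>

abbreviation std_mpoly :: "nat \<times> nat \<times> nat \<Rightarrow> (gg_var, 'a::field) mpoly"
  where "std_mpoly \<equiv> std_monom (mvar M12) (mvar M11) (- mvar M21) (mvar N12) (mvar N11) (- mvar N21)"

text \<open>One scalar and one exponent triple serve both conditions, so the normal form can be read
  off from the restriction. The bound on \<open>j\<close> is what \<open>std_monom_step\<close> asks
  for.\<close>

definition has_normal_form :: "(gg_var, 'a::field) mpoly \<Rightarrow> bool"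
  where "has_normal_form f \<longleftrightarrow> (\<exists>c k l j. j \<le> 2 * (k + l) \<and>
    cell_restrict f = Poly_Mapping.single (k, l, j) c \<and> f - mconst c * std_mpoly (k, l, j) \<in> rel_ideal)"

lemma has_normal_form_mvar_mult:
  fixes f :: "(gg_var, 'a::field) mpoly"
  assumes two: "(2::'a) \<noteq> 0" and "has_normal_form f"
  shows "has_normal_form (mvar v * f)"
proof -
  let ?J = "rel_ideal :: (gg_var, 'a) mpoly set"
  note J = ideal_rel_ideal and cl = ideal_closed[OF ideal_rel_ideal]
  obtain c k l j where j: "j \<le> 2 * (k + l)" and res: "cell_restrict f = Poly_Mapping.single (k, l, j) c"
    and f: "f - mconst c * std_mpoly (k, l, j) \<in> ?J"
    using assms(2) unfolding has_normal_form_def by blast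
  \<comment> \<open>Here \<open>s\<close> is the sign in the restriction of \<open>v\<close>:
    \<open>- 1\<close> for \<open>M21\<close> and \<open>N21\<close>, and \<open>1\<close>
    otherwise.\<close>
  have normal_formI: ?thesis
    if j': "j' \<le> 2 * (k' + l')" and s: "s * s = 1"
      and v: "cell_coords v = Poly_Mapping.single w s" "w + (k, l, j) = (k', l', j')"
      and step: "mconst s * mvar v * std_mpoly (k, l, j) - std_mpoly (k', l', j') \<in> ?J"
    for s w k' l' j'
  proof -
    have ss: "mconst s * mconst s = (1 :: (gg_var, 'a) mpoly)"
      using s by (simp add: mconst_hom(3) flip: mconst_hom(2))
    \<comment> \<open>The middle summand is zero because \<open>s * s = 1\<close>; it makes the
      equation a formal identity.\<close>
    have "mvar v * f - mconst (s * c) * std_mpoly (k', l', j') =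
        mvar v * (f - mconst c * std_mpoly (k, l, j)) +
        (mconst s * mconst s - 1) * (- mvar v * mconst c * std_mpoly (k, l, j)) +
        mconst (s * c) * (mconst s * mvar v * std_mpoly (k, l, j) - std_mpoly (k', l', j'))"
      by (simp add: mconst_hom(2) algebra_simps del: std_monom.simps)
    then have "mvar v * f - mconst (s * c) * std_mpoly (k', l', j') \<in> ?J"
      using cl(2)[OF cl(3)[OF f, of "mvar v"] cl(3)[OF step, of "mconst (s * c)"]] ss by simp
    moreover have "cell_restrict (mvar v * f) = Poly_Mapping.single (k', l', j') (s * c)"
      using res v by (simp add: cell_restrict_def poly_eval_single_0_hom mult_single)
    ultimately show ?thesis using j' unfolding has_normal_form_def by blast
  qed
  have neg: "mconst (- 1) = (- 1 :: (gg_var, 'a) mpoly)"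
    by (simp add: mconst_def single_uminus)
  note step = std_monom_step[OF J rel_ideal_minors[OF two] j]
  note simps = cell_coords_def mconst_hom(3) neg
  show ?thesis
  proof (cases v)
    case M11
    show ?thesis by (rule normal_formI[of "j + 1" "k + 1" l 1 "(1, 0, 1)"])
      (use M11 j step(2) in \<open>simp_all add: simps del: std_monom.simps\<close>)
  next
    case M12
    show ?thesis by (rule normal_formI[of j "k + 1" l 1 "(1, 0, 0)"])
      (use M12 j step(1) in \<open>simp_all add: simps del: std_monom.simps\<close>)
  next
    case M21
    show ?thesis by (rule normal_formI[of "j + 2" "k + 1" l "- 1" "(1, 0, 2)"])
      (use M21 j step(3) in \<open>simp_all add: simps del: std_monom.simps\<close>)
  next
    case N11
    show ?thesis by (rule normal_formI[of "j + 1" k "l + 1" 1 "(0, 1, 1)"])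
      (use N11 j step(5) in \<open>simp_all add: simps del: std_monom.simps\<close>)
  next
    case N12
    show ?thesis by (rule normal_formI[of j k "l + 1" 1 "(0, 1, 0)"])
      (use N12 j step(4) in \<open>simp_all add: simps del: std_monom.simps\<close>)
  next
    case N21
    show ?thesis by (rule normal_formI[of "j + 2" k "l + 1" "- 1" "(0, 1, 2)"])
      (use N21 j step(6) in \<open>simp_all add: simps del: std_monom.simps\<close>)
  qed
qed

lemma has_normal_form_monomial:
  assumes two: "(2::'a::field) \<noteq> 0"
  shows "has_normal_form (Poly_Mapping.single m (c :: 'a))"
proof -
  have step: "has_normal_form (Poly_Mapping.single (Poly_Mapping.single v n + m) c)"
    if "has_normal_form (Poly_Mapping.single m c)" for v n m
  proof (induction n)
    case (Suc n)
    have "Poly_Mapping.single (Poly_Mapping.single v (Suc n) + m) c =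
        mvar v * Poly_Mapping.single (Poly_Mapping.single v n + m) c"
      using single_add[of v 1 n] by (simp add: mvar_def mult_single add.assoc[symmetric])
    with has_normal_form_mvar_mult[OF two Suc, of v] show ?case by simp
  qed (use that in simp)
  have "cell_restrict (Poly_Mapping.single 0 c) = Poly_Mapping.single (0, 0, 0) c"
    by (simp add: cell_restrict_def poly_eval_def zero_prod_def)
  then have zero: "has_normal_form (Poly_Mapping.single 0 c)"
    unfolding has_normal_form_def
    by (intro exI[of _ c] exI[of _ 0]) (simp add: mconst_def ideal_closed(1)[OF ideal_rel_ideal])
  have "has_normal_form (Poly_Mapping.single (\<Sum>v\<in>A. Poly_Mapping.single v (g v)) c)" for A g
    by (induction A rule: infinite_finite_induct) (simp_all add: zero step)
  moreover have "m = (\<Sum>v\<in>Poly_Mapping.keys m. Poly_Mapping.single v (Poly_Mapping.lookup m v))"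
    by (rule poly_mapping_eqI) (simp add: lookup_sum lookup_single when_def in_keys_iff)
  ultimately show ?thesis by metis
qed

text \<open>The additive map \<open>T\<close> lifts \<open>x^k y^l t^j\<close> to its standard
  monomial. By the normal forms, a monomial is congruent to \<open>T\<close> of its restriction;
  additivity extends this to every \<open>f\<close>, and \<open>T 0 = 0\<close>.\<close>

lemma cell_restrict_zero_imp_rel_ideal:
  fixes f :: "(gg_var, 'a::field) mpoly"
  assumes two: "(2::'a) \<noteq> 0" and "cell_restrict f = 0"
  shows "f \<in> rel_ideal"
proof -
  let ?J = "rel_ideal :: (gg_var, 'a) mpoly set"
  note cl = ideal_closed[OF ideal_rel_ideal]
  define T :: "((nat \<times> nat \<times> nat) \<Rightarrow>\<^sub>0 'a) \<Rightarrow> (gg_var, 'a) mpoly" where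
    "T g = (\<Sum>m\<in>Poly_Mapping.keys g. mconst (Poly_Mapping.lookup g m) * std_mpoly m)" for g
  have mc0: "mconst 0 = (0 :: (gg_var, 'a) mpoly)" by (simp add: mconst_def)
  have T_add: "T (g + g') = T g + T g'" for g g'
    unfolding T_def by (rule setsum_keys_plus_distrib) (simp_all add: mc0 mconst_hom(1) distrib_right)
  have T_single: "T (Poly_Mapping.single m c) = mconst c * std_mpoly m" for m c
    by (simp add: T_def mc0)
  have T_sum: "sum F A - T (cell_restrict (sum F A)) \<in> ?J"
    if "\<And>m. F m - T (cell_restrict (F m)) \<in> ?J" for F :: "(gg_var \<Rightarrow>\<^sub>0 nat) \<Rightarrow> (gg_var, 'a) mpoly" and A
  proof (induction A rule: infinite_finite_induct)
    case (insert m A)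
    have "sum F (insert m A) - T (cell_restrict (sum F (insert m A))) =
        (F m - T (cell_restrict (F m))) + (sum F A - T (cell_restrict (sum F A)))"
      using insert.hyps by (simp add: cell_restrict_def poly_eval_single_0_hom T_add)
    then show ?case using cl(2)[OF that insert.IH] by simp
  qed (simp_all add: cell_restrict_def T_def cl(1))
  have single: "Poly_Mapping.single m c - T (cell_restrict (Poly_Mapping.single m c)) \<in> ?J" for m c
    using has_normal_form_monomial[OF two, of m c]
    by (auto simp: has_normal_form_def T_single simp del: std_monom.simps)
  let ?s = "\<Sum>m\<in>Poly_Mapping.keys f. Poly_Mapping.single m (Poly_Mapping.lookup f m)"
  have "?s = f"
    by (rule poly_mapping_eqI) (simp add: lookup_sum lookup_single when_def in_keys_iff)
  moreover have "?s - T (cell_restrict ?s) \<in> ?J"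
    by (rule T_sum) (rule single)
  ultimately have "f - T (cell_restrict f) \<in> ?J"
    by simp
  then show ?thesis using assms(2) by (simp add: T_def)
qed

section \<open>The kernel\<close>

lemma a_kernel_p_sharp_iff:
  "f \<in> a_kernel S_ring H0_Y p_sharp \<longleftrightarrow> poly_eval mconst (p_coords mvar) f \<in> gnn_ideal"
proof -
  have "gnn_ideal +>\<^bsub>ring_of_type_algebra\<^esub> 0 = (gnn_ideal :: (gnn_var, 'a) mpoly set)"
    using abelian_group.a_coset_add_zero[OF ring.is_abelian_group[OF ring_from_type_algebra], of gnn_ideal]
    by simp
  then show ?thesis
    using coset_eq_iff[OF gnn_ideal, of "poly_eval mconst (p_coords mvar) f" 0]
    by (simp add: a_kernel_def' S_ring_def H0_Y_def FactRing_def p_sharp_def)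
qed

lemma a_kernel_p_sharp:
  assumes two: "(2::'a::field) \<noteq> 0"
  shows "a_kernel (S_ring :: (gg_var, 'a) mpoly ring) H0_Y p_sharp = rel_ideal"
proof
  show "a_kernel (S_ring :: (gg_var, 'a) mpoly ring) H0_Y p_sharp \<subseteq> rel_ideal"
    by (rule subsetI, rule cell_restrict_zero_imp_rel_ideal[OF two],
      rule p_sharp_zero_imp_cell_restrict_zero) (simp add: a_kernel_p_sharp_iff)
  let ?k = "poly_eval mconst (p_coords mvar) :: (gg_var, 'a) mpoly \<Rightarrow> (gnn_var, 'a) mpoly"
  \<comment> \<open>The relations become the zero polynomial here: \<open>adj2 g ** g\<close> is
    scalar, and a product of two strictly upper triangular matrices vanishes.\<close>
  have "\<forall>f\<in>rel_ideal. ?k f \<in> gnn_ideal"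
    unfolding poly_eval_rel_ideal_iff[of mconst, OF mconst_hom gnn_ideal]
    by (simp add: mat_M_def mat_N_def det_2 trace_def matrix_matrix_mult_def sum_2 forall_2
      p_coords_def gg_coords_def Ad_def adj2_def mat_g_def nil_M_def nil_N_def
      ideal_closed(1)[OF gnn_ideal] algebra_simps)
  then show "rel_ideal \<subseteq> a_kernel (S_ring :: (gg_var, 'a) mpoly ring) H0_Y p_sharp"
    by (auto simp: a_kernel_p_sharp_iff)
qed

lemma subscheme_points_rel_ideal:
  fixes h :: "'a::field \<Rightarrow> 'r::comm_ring_1"
  assumes "h \<in> ring_hom ring_of_type_algebra ring_of_type_algebra"
  shows "subscheme_points rel_ideal h =
    {(A, B). trace A = 0 \<and> trace B = 0 \<and> det A = 0 \<and> det B = 0 \<and> A ** B = B ** A \<and> trace (A ** B) = 0}"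
proof -
  have hom: "h (a + b) = h a + h b" "h (a * b) = h a * h b" "h 1 = 1" for a b
    using ring_hom_add[OF assms, of a b] ring_hom_mult[OF assms, of a b] ring_hom_one[OF assms] by simp_all
  have "(\<forall>f\<in>rel_ideal. poly_eval h (gg_coords A B) f = 0) \<longleftrightarrow>
      det A = 0 \<and> det B = 0 \<and> A ** B = B ** A \<and> trace (A ** B) = 0"
    if "trace A = 0" "trace B = 0" for A B
  proof -
    \<comment> \<open>Trace zero recovers the lower right entries, which are not among the
      coordinates.\<close>
    have "mat_M (gg_coords A B) = A" "mat_N (gg_coords A B) = B"
      using that by (simp_all add: vec_eq_iff forall_2 mat_M_def mat_N_def gg_coords_def trace_def
        sum_2 neg_eq_iff_add_eq_0)
    moreover have "A ** B = B ** A \<longleftrightarrow> (\<forall>i j. (A ** B - B ** A)$i$j = 0)"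
      by (simp add: vec_eq_iff)
    ultimately show ?thesis
      using poly_eval_rel_ideal_iff[of h, OF hom ideal_zero_type_algebra, of "gg_coords A B"] by auto
  qed
  then show ?thesis unfolding subscheme_points_def by blast
qed

theorem theorem5p3:
  fixes l :: nat
    and h :: "'a::field \<Rightarrow> 'r::comm_ring_1"
  assumes "CHAR('a) = l" and "l > 2"
  shows "a_kernel (S_ring :: (gg_var, 'a) mpoly ring) H0_Y p_sharp =
           Idl\<^bsub>S_ring\<^esub> ({det univ_M, det univ_N, trace (univ_M ** univ_N)} \<union>
             {(univ_M ** univ_N - univ_N ** univ_M)$i$j | i j. True})
       \<and> (h \<in> ring_hom ring_of_type_algebra ring_of_type_algebra \<longrightarrow>
          subscheme_points (a_kernel S_ring H0_Y p_sharp) h =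
            {(A, B). trace A = 0 \<and> trace B = 0 \<and> det A = 0 \<and> det B = 0 \<and>
                     A ** B = B ** A \<and> trace (A ** B) = 0})"
proof -
  have "(2::'a) \<noteq> 0"
    using of_nat_eq_0_iff_char_dvd[where 'a = 'a, of 2] assms by (auto dest: dvd_imp_le)
  note kernel = a_kernel_p_sharp[OF this]
  show ?thesis
    unfolding kernel unfolding rel_ideal_def[symmetric] using subscheme_points_rel_ideal[of h] by blast
qed

end
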